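(* Let $n\ge 2$ and let $\boldsymbol X=(X_1,\dots,X_n)$ and $\boldsymbol Y=(Y_1,\dots,Y_n)$ be two nonnegative random vectors with joint distribution functions $F$ and $G$, joint densities, and marginal distribution functions $F_1,\dots,F_n$ and $G_1,\dots,G_n$, respectively, that are continuous and have finite expectations. Suppose that $\boldsymbol X$ and $\boldsymbol Y$ have the same copula $C$, and that $C$ is such that $X_1\uparrow_{\rm RTI}(X_2,\dots,X_n)$. Then, for $p_1\in(0,1)$ and $(p_2,\dots,p_n)\in(1/2,1)^{n-1}$, with $\boldsymbol p=(p_1,\dots,p_n)$, $X_1\le_{\star}Y_1$ implies that $$\Delta^{\rm R-med}{\rm MCoVaR}_{\boldsymbol p}[X_1|X_2,\dots,X_n]\le \Delta^{\rm R-med}{\rm MCoVaR}_{\boldsymbol p}[Y_1|Y_2,\dots,Y_n].$$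
   Context: Throughout, "increasing" means nondecreasing. Value-at-Risk: for a random variable $X$ with distribution function $F_X$ and $p\in(0,1)$, ${\rm VaR}_p[X]=F_X^{-1}(p)=\inf\{x\in\mathbb R: F_X(x)\ge p\}$; the VaR of a conditional random variable is the quantile of its conditional distribution. Multivariate CoVaR: for $\boldsymbol p=(p_1,\dots,p_n)\in(0,1)^n$, ${\rm MCoVaR}_{\boldsymbol p}[X_1|X_2,\dots,X_n]={\rm VaR}_{p_1}\big[X_1\,\big|\,\bigcap_{j=2}^n\{X_j>{\rm VaR}_{p_j}[X_j]\}\big]$ (the conditioning event is assumed to have positive probability whenever this is written). Write $\boldsymbol p=(p_1,\boldsymbol p_{[-1]})$ with $\boldsymbol p_{[-1]}=(p_2,\dots,p_n)$, and $\frac{\boldsymbol 1}{\boldsymbol 2}=(\frac12,\dots,\frac12)\in\mathbb R^{n-1}$. Median-type ratio-based contribution: for $p_1\in(0,1)$ and $\boldsymbol p_{[-1]}\in(1/2,1)^{n-1}$, $$\Delta^{\rm R-med}{\rm MCoVaR}_{\boldsymbol p}[X_1|X_2,\dots,X_n]=\frac{{\rm MCoVaR}_{p_1,\boldsymbol p_{[-1]}}[X_1|X_2,\dots,X_n]-{\rm MCoVaR}_{p_1,\frac{\boldsymbol 1}{\boldsymbol 2}}[X_1|X_2,\dots,X_n]}{{\rm MCoVaR}_{p_1,\frac{\boldsymbol 1}{\boldsymbol 2}}[X_1|X_2,\dots,X_n]},$$ defined when the denominator is nonzero. The same definitions apply to $\boldsymbol Y$. Copula: the copula $C$ of $\boldsymbol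 X$ is the joint distribution function on $[0,1]^n$ of $(F_1(X_1),\dots,F_n(X_n))$, so $F(x_1,\dots,x_n)=C(F_1(x_1),\dots,F_n(x_n))$; similarly for $\boldsymbol Y$ with $G_i(Y_i)$. Right-tail increasing: $X_1\uparrow_{\rm RTI}(X_2,\dots,X_n)$ means that $\mathbb P(X_1>x_1\mid X_2>x_2,\dots,X_n>x_n)$ is increasing in each $x_j$, $j=2,\dots,n$, for every $x_1$ (where the conditioning event has positive probability). Star order: for nonnegative random variables $X,Y$, $X\le_\star Y$ means that $F_Y^{-1}(p)/F_X^{-1}(p)$ is increasing in $p\in(0,1)$. *)

theory Defs
  imports "HOL-Probability.Probability"
begin

text \<open>
  A random vector of length \<open>n\<close> is a family \<open>X i\<close> of real random variables on a probability space
  \<open>M\<close>, of which only the components with index in \<open>{1..n}\<close> are relevant.  Likewise only the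
  components in \<open>{1..n}\<close> of a level vector \<open>p\<close> matter.
\<close>

definition VaR :: "'a measure \<Rightarrow> ('a \<Rightarrow> real) \<Rightarrow> real \<Rightarrow> real" where
  "VaR M X p = Inf {x. cdf (distr M borel X) x \<ge> p}"

definition stress_event :: "nat \<Rightarrow> 'a measure \<Rightarrow> (nat \<Rightarrow> 'a \<Rightarrow> real) \<Rightarrow> (nat \<Rightarrow> real) \<Rightarrow> 'a set" where
  "stress_event n M X p = {\<omega> \<in> space M. \<forall>j\<in>{2..n}. X j \<omega> > VaR M (X j) (p j)}"

text \<open>
  \<open>uniform_measure M A\<close> is the conditional probability given \<open>A\<close>, so that the following is the
  quantile of the conditional distribution of \<open>X 1\<close>.  It is meaningful only if the conditioning
  event has positive probability.
\<close>

definition MCoVaR :: "nat \<Rightarrow> 'a measure \<Rightarrow> (nat \<Rightarrow> 'a \<Rightarrow> real) \<Rightarrow> (nat \<Rightarrow> real) \<Rightarrow> real" where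
  "MCoVaR n M X p = VaR (uniform_measure M (stress_event n M X p)) (X 1) (p 1)"

definition median_levels :: "(nat \<Rightarrow> real) \<Rightarrow> nat \<Rightarrow> real" where
  "median_levels p = (\<lambda>j. if j = 1 then p 1 else 1/2)"

definition Delta_R_med_MCoVaR ::
    "nat \<Rightarrow> 'a measure \<Rightarrow> (nat \<Rightarrow> 'a \<Rightarrow> real) \<Rightarrow> (nat \<Rightarrow> real) \<Rightarrow> real" where
  "Delta_R_med_MCoVaR n M X p =
     (MCoVaR n M X p - MCoVaR n M X (median_levels p)) / MCoVaR n M X (median_levels p)"

text \<open>
  \<open>C\<close> is constrained on the unit cube only; its arguments are vectors indexed by \<open>{1..n}\<close>.
\<close>

definition has_copula ::
    "nat \<Rightarrow> 'a measure \<Rightarrow> (nat \<Rightarrow> 'a \<Rightarrow> real) \<Rightarrow> ((nat \<Rightarrow> real) \<Rightarrow> real) \<Rightarrow> bool" where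
  "has_copula n M X C \<longleftrightarrow>
     (\<forall>u. (\<forall>i\<in>{1..n}. u i \<in> {0..1}) \<longrightarrow>
        C u = \<P>(\<omega> in M. \<forall>i\<in>{1..n}. cdf (distr M borel (X i)) (X i \<omega>) \<le> u i))"

text \<open>
  Monotonicity in each coordinate separately.  If the conditioning event has positive probability
  at the larger threshold, then it also does at the smaller one.
\<close>

definition right_tail_increasing ::
    "nat \<Rightarrow> 'a measure \<Rightarrow> (nat \<Rightarrow> 'a \<Rightarrow> real) \<Rightarrow> bool" where
  "right_tail_increasing n M X \<longleftrightarrow>
     (\<forall>x1 x. \<forall>j\<in>{2..n}. \<forall>y\<ge>x j.
        \<P>(\<omega> in M. \<forall>k\<in>{2..n}. X k \<omega> > (x(j := y)) k) > 0 \<longrightarrow>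
        \<P>(\<omega> in M. X 1 \<omega> > x1 \<bar> \<forall>k\<in>{2..n}. X k \<omega> > x k)
          \<le> \<P>(\<omega> in M. X 1 \<omega> > x1 \<bar> \<forall>k\<in>{2..n}. X k \<omega> > (x(j := y)) k))"

text \<open>
  For nonnegative random variables.  The two variables may live on different probability spaces.
  The quotient is the one of the mathematical definition where the quantile of \<open>X\<close> is positive; for
  nonnegative \<open>X\<close> with continuous distribution function this is the case on all of \<open>(0,1)\<close>.
\<close>

definition star_order ::
    "'a measure \<Rightarrow> ('a \<Rightarrow> real) \<Rightarrow> 'b measure \<Rightarrow> ('b \<Rightarrow> real) \<Rightarrow> bool" where
  "star_order M X N Y \<longleftrightarrow> mono_on {0<..<1} (\<lambda>p. VaR N Y p / VaR M X p)"

end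

theory Submission
  imports Defs
begin

text \<open>
  Let \<open>F\<^sub>j\<close> be the distribution function of \<open>X\<^sub>j\<close>.  Up to null sets, \<open>X\<^sub>1 \<le> x\<close> is the event
  \<open>F\<^sub>1(X\<^sub>1) \<le> F\<^sub>1(x)\<close> and \<open>X\<^sub>j > VaR\<close> at level \<open>p\<^sub>j\<close> is the event \<open>F\<^sub>j(X\<^sub>j) > p\<^sub>j\<close>, so the conditional
  distribution function of \<open>X\<^sub>1\<close> is \<open>H(F\<^sub>1(x))\<close> with \<open>H\<close> depending on the copula only.  Hence MCoVaR is
  the marginal quantile at a level that is the same for \<open>X\<close> and \<open>Y\<close>.  By RTI this level is larger for
  the given thresholds than for the medians, and the star order compares the quotients of
  the quantiles at these two levels.
\<close>

section \<open>Quantiles and distribution functions of a single variable\<close>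

context prob_space
begin

lemma cdf_distr_eq:
  assumes [measurable]: "X \<in> borel_measurable M"
  shows "cdf (distr M borel X) x = prob {\<omega> \<in> space M. X \<omega> \<le> x}"
proof -
  have "X -` {..x} \<inter> space M = {\<omega> \<in> space M. X \<omega> \<le> x}" by auto
  then show ?thesis by (simp add: cdf_def measure_distr)
qed

text \<open>This is the Galois connection between quantile and distribution function;
  right-continuity makes the infimum attained. Comparisons of quantiles below are reduced to
  it.\<close>

lemma VaR_le_iff:
  assumes "X \<in> borel_measurable M" "0 < q" "q < 1"
  shows "VaR M X q \<le> x \<longleftrightarrow> q \<le> cdf (distr M borel X) x"
proof -
  interpret D: cdf_distribution "distr M borel X"
    using assms(1) by (simp add: cdf_distribution_def)
  show ?thesis
    unfolding VaR_def by (rule D.pseudoinverse[OF assms(2,3), symmetric])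
qed

text \<open>The Galois connection gives one inequality and keeps the distribution function below
  \<open>q\<close> strictly to the left of the quantile. Left-continuity carries that bound to the
  quantile itself.\<close>

lemma cdf_VaR:
  assumes X: "X \<in> borel_measurable M" and cont: "continuous_on UNIV (cdf (distr M borel X))"
    and q: "0 < q" "q < 1"
  shows "cdf (distr M borel X) (VaR M X q) = q"
proof (rule antisym)
  let ?F = "cdf (distr M borel X)"
  show "q \<le> ?F (VaR M X q)"
    using VaR_le_iff[OF X q] by blast
  have "(?F \<longlongrightarrow> ?F (VaR M X q)) (at_left (VaR M X q))"
    using cont by (auto simp: continuous_on_eq_continuous_at isCont_def
        intro: filterlim_mono[OF _ order_refl at_le])
  moreover have "\<forall>\<^sub>F x in at_left (VaR M X q). ?F x \<le> q"
  proof (rule eventually_at_leftI[of "VaR M X q - 1"])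
    fix x assume "x \<in> {VaR M X q - 1<..<VaR M X q}"
    then show "?F x \<le> q"
      using VaR_le_iff[OF X q, of x] by auto
  qed simp
  ultimately show "?F (VaR M X q) \<le> q"
    by (rule tendsto_upperbound) simp
qed

text \<open>The two events differ by a half-open interval whose probability is the difference of the
  two distribution values.\<close>

lemma cdf_eq_imp_AE_le_iff:
  assumes X[measurable]: "X \<in> borel_measurable M"
    and eq: "cdf (distr M borel X) x = cdf (distr M borel X) y"
  shows "AE \<omega> in M. X \<omega> \<le> x \<longleftrightarrow> X \<omega> \<le> y"
proof -
  have *: "AE \<omega> in M. X \<omega> \<le> a \<longleftrightarrow> X \<omega> \<le> b"
    if "a \<le> b" "cdf (distr M borel X) a = cdf (distr M borel X) b" for a b
  proof -
    have "prob {\<omega>\<in>space M. X \<omega> \<le> b} - prob {\<omega>\<in>space M. X \<omega> \<le> a} =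
        prob ({\<omega>\<in>space M. X \<omega> \<le> b} - {\<omega>\<in>space M. X \<omega> \<le> a})"
      using \<open>a \<le> b\<close> by (intro finite_measure_Diff[symmetric]) auto
    also have "{\<omega>\<in>space M. X \<omega> \<le> b} - {\<omega>\<in>space M. X \<omega> \<le> a} = {\<omega>\<in>space M. a < X \<omega> \<and> X \<omega> \<le> b}"
      by auto
    finally have "prob {\<omega>\<in>space M. a < X \<omega> \<and> X \<omega> \<le> b} = 0"
      using that(2) by (simp add: cdf_distr_eq)
    then have "AE \<omega> in M. \<omega> \<notin> {\<omega>\<in>space M. a < X \<omega> \<and> X \<omega> \<le> b}"
      by (subst (asm) prob_eq_0) auto
    then have "AE \<omega> in M. \<not> (a < X \<omega> \<and> X \<omega> \<le> b)"
      using AE_space by eventually_elim auto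
    then show ?thesis
      by (rule eventually_mono) (use \<open>a \<le> b\<close> in auto)
  qed
  show ?thesis
  proof (cases "x \<le> y")
    case True
    from *[OF this eq] show ?thesis .
  next
    case False
    with *[of y x] eq show ?thesis by (auto elim!: eventually_mono)
  qed
qed

text \<open>The two events can differ on a flat piece of the distribution function, which is a null set.\<close>

lemma AE_le_iff_cdf_le:
  assumes X[measurable]: "X \<in> borel_measurable M"
    and cont: "continuous_on UNIV (cdf (distr M borel X))"
  shows "AE \<omega> in M. X \<omega> \<le> x \<longleftrightarrow> cdf (distr M borel X) (X \<omega>) \<le> cdf (distr M borel X) x"
proof -
  interpret D: real_distribution "distr M borel X" by simp
  let ?F = "cdf (distr M borel X)"
  \<comment> \<open>The sublevel set \<open>K\<close> is closed and contains \<open>x\<close>. If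
    bounded, it is the half-line up to \<open>Sup K\<close>, and the distribution function is flat
    between \<open>x\<close> and \<open>Sup K\<close>.\<close>
  define K where "K = {t. ?F t \<le> ?F x}"
  show ?thesis
  proof (cases "bdd_above K")
    case True
    have "x \<in> K" by (simp add: K_def)
    have "closed K"
      unfolding K_def by (intro closed_Collect_le cont continuous_on_const)
    then have "Sup K \<in> K"
      using True \<open>x \<in> K\<close> by (intro closed_contains_Sup) auto
    moreover have "x \<le> Sup K"
      using True \<open>x \<in> K\<close> by (rule cSup_upper[rotated])
    ultimately have "?F x = ?F (Sup K)"
      by (auto simp: K_def intro: antisym D.cdf_nondecreasing)
    then have "AE \<omega> in M. X \<omega> \<le> x \<longleftrightarrow> X \<omega> \<le> Sup K"
      by (rule cdf_eq_imp_AE_le_iff[OF X])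
    moreover have "t \<le> Sup K \<longleftrightarrow> ?F t \<le> ?F x" for t
      using \<open>Sup K \<in> K\<close> True D.cdf_nondecreasing[of t "Sup K"]
      by (auto simp: K_def intro: cSup_upper)
    ultimately show ?thesis by simp
  next
    case False
    have le: "?F t \<le> ?F x" for t
    proof -
      from False obtain s where "s \<in> K" "t \<le> s"
        by (meson bdd_above.I linear)
      then show ?thesis
        using D.cdf_nondecreasing[of t s] by (simp add: K_def)
    qed
    \<comment> \<open>An unbounded \<open>K\<close> makes \<open>?F x\<close> an upper bound of the
      whole distribution function, hence of its limit 1; both sides of the equivalence then hold
      almost surely.\<close>
    have "1 \<le> ?F x"
      by (rule tendsto_upperbound[OF D.cdf_lim_at_top_prob]) (auto simp: le)
    then have "prob {\<omega>\<in>space M. X \<omega> \<le> x} = 1"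
      using prob_le_1 by (simp add: cdf_distr_eq antisym)
    then have "AE \<omega> in M. X \<omega> \<le> x"
      by (subst (asm) prob_Collect_eq_1) auto
    then show ?thesis by (auto simp: le)
  qed
qed

lemma AE_VaR_less_iff:
  assumes X: "X \<in> borel_measurable M" and cont: "continuous_on UNIV (cdf (distr M borel X))"
    and q: "0 < q" "q < 1"
  shows "AE \<omega> in M. VaR M X q < X \<omega> \<longleftrightarrow> q < cdf (distr M borel X) (X \<omega>)"
  using AE_le_iff_cdf_le[OF X cont, of "VaR M X q"]
  unfolding cdf_VaR[OF X cont q] by eventually_elim linarith

text \<open>If the quantile at \<open>q\<close> were at most 0, the strictly smaller quantile at
  \<open>q / 2\<close> would be negative. A nonnegative variable has no mass up to there, while
  continuity gives that point the distribution value \<open>q / 2\<close>.\<close>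

lemma VaR_pos:
  assumes X: "X \<in> borel_measurable M" and cont: "continuous_on UNIV (cdf (distr M borel X))"
    and nonneg: "AE \<omega> in M. 0 \<le> X \<omega>" and q: "0 < q" "q < 1"
  shows "0 < VaR M X q"
proof (rule ccontr)
  let ?F = "cdf (distr M borel X)"
  assume "\<not> 0 < VaR M X q"
  moreover have half: "?F (VaR M X (q / 2)) = q / 2"
    using q by (intro cdf_VaR X cont) auto
  then have "VaR M X (q / 2) < VaR M X q"
    using VaR_le_iff[OF X q, of "VaR M X (q / 2)"] q by simp
  ultimately have "AE \<omega> in M. \<not> X \<omega> \<le> VaR M X (q / 2)"
    using nonneg by (auto elim!: eventually_mono)
  then have "?F (VaR M X (q / 2)) = 0"
    unfolding cdf_distr_eq[OF X] using X by (subst prob_eq_0) auto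
  with half q show False by simp
qed

section \<open>Conditioning on an event of positive probability\<close>

lemma prob_space_uniform_measure_pos:
  assumes "0 < prob A"
  shows "prob_space (uniform_measure M A)"
  using assms by (intro prob_space_uniform_measure) (auto simp: measure_def)

lemma cdf_distr_uniform_measure:
  assumes A: "A \<in> events" "0 < prob A" and X[measurable]: "X \<in> borel_measurable M"
  shows "cdf (distr (uniform_measure M A) borel X) x =
    prob {\<omega>\<in>A. X \<omega> \<le> x} / prob A"
proof -
  have "emeasure M A \<noteq> 0" using A by (auto simp: measure_def)
  interpret U: prob_space "uniform_measure M A" by (rule prob_space_uniform_measure_pos) fact
  have "A \<inter> {\<omega>\<in>space M. X \<omega> \<le> x} = {\<omega>\<in>A. X \<omega> \<le> x}"
    using sets.sets_into_space[OF A(1)] by auto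
  then show ?thesis
    using A \<open>emeasure M A \<noteq> 0\<close> by (subst U.cdf_distr_eq) auto
qed

text \<open>Continuity means absence of atoms, and conditioning cannot create an atom.\<close>

lemma continuous_cdf_uniform_measure:
  assumes A: "A \<in> events" "0 < prob A" and X[measurable]: "X \<in> borel_measurable M"
    and cont: "continuous_on UNIV (cdf (distr M borel X))"
  shows "continuous_on UNIV (cdf (distr (uniform_measure M A) borel X))"
proof -
  interpret D: real_distribution "distr M borel X" by simp
  interpret U: prob_space "uniform_measure M A" by (rule prob_space_uniform_measure_pos) fact
  interpret E: real_distribution "distr (uniform_measure M A) borel X" by simp
  have "isCont (cdf (distr (uniform_measure M A) borel X)) x" for x
  proof -
    have "prob (X -` {x} \<inter> space M) = 0"
      using cont D.isCont_cdf[of x]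
      by (simp add: continuous_on_eq_continuous_at measure_distr)
    moreover have "prob (A \<inter> (X -` {x} \<inter> space M)) \<le> prob (X -` {x} \<inter> space M)"
      by (intro finite_measure_mono) auto
    ultimately have "prob (A \<inter> (X -` {x} \<inter> space M)) = 0"
      using measure_nonneg[of M "A \<inter> (X -` {x} \<inter> space M)"] by linarith
    then show ?thesis
      using A by (simp add: E.isCont_cdf measure_distr emeasure_eq_measure)
  qed
  then show ?thesis by (simp add: continuous_on_eq_continuous_at)
qed

text \<open>A conditional quantile is thereby a marginal quantile at some level strictly between 0
  and 1. The level is not 0 because \<open>A\<close> has mass up to \<open>m\<close>, and not 1
  because otherwise the conditional distribution value at \<open>m\<close> would be 1 instead of
  \<open>p\<close>.\<close>

lemma VaR_uniform_measure:
  fixes X A p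
  defines "m \<equiv> VaR (uniform_measure M A) X p"
  assumes A: "A \<in> events" "0 < prob A" and X[measurable]: "X \<in> borel_measurable M"
    and cont: "continuous_on UNIV (cdf (distr M borel X))" and p: "0 < p" "p < 1"
  shows "0 < cdf (distr M borel X) m" "cdf (distr M borel X) m < 1"
    "VaR M X (cdf (distr M borel X) m) = m"
proof -
  interpret U: prob_space "uniform_measure M A" by (rule prob_space_uniform_measure_pos) fact
  let ?F = "cdf (distr M borel X)" and ?G = "cdf (distr (uniform_measure M A) borel X)"
  have XU: "X \<in> borel_measurable (uniform_measure M A)" by simp
  note G = cdf_distr_uniform_measure[OF A X]
  have Gm: "?G m = p"
    unfolding m_def
    by (rule U.cdf_VaR[OF XU continuous_cdf_uniform_measure[OF A X cont] p])
  have Asub: "A \<subseteq> space M" using A sets.sets_into_space by auto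
  have meas: "{\<omega>\<in>A. X \<omega> \<le> x} \<in> events" for x
  proof -
    have "{\<omega>\<in>A. X \<omega> \<le> x} = A \<inter> {\<omega>\<in>space M. X \<omega> \<le> x}" using Asub by auto
    then show ?thesis using A by simp
  qed
  have Fdef: "?F x = prob {\<omega>\<in>space M. X \<omega> \<le> x}" for x by (rule cdf_distr_eq) simp
  have "prob {\<omega>\<in>A. X \<omega> \<le> m} > 0"
    using Gm p A G[of m] by (metis divide_eq_0_iff less_irrefl measure_nonneg order_le_less)
  also have "prob {\<omega>\<in>A. X \<omega> \<le> m} \<le> ?F m"
    unfolding Fdef using Asub by (intro finite_measure_mono) auto
  finally show pos: "0 < ?F m" .
  show lt1: "?F m < 1"
  proof (rule ccontr)
    assume "\<not> ?F m < 1"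
    then have "prob {\<omega>\<in>space M. X \<omega> \<le> m} = 1"
      using prob_le_1 by (simp add: Fdef antisym)
    then have "AE \<omega> in M. X \<omega> \<le> m"
      by (subst (asm) prob_Collect_eq_1) auto
    then have "prob {\<omega>\<in>A. X \<omega> \<le> m} = prob A"
      by (intro finite_measure_eq_AE meas A) auto
    then show False using Gm G[of m] A p by simp
  qed
  show "VaR M X (?F m) = m"
  proof (rule antisym)
    show le: "VaR M X (?F m) \<le> m"
      by (simp add: VaR_le_iff[OF X pos lt1])
    \<comment> \<open>The marginal quantile at level \<open>?F m\<close> could a priori lie at the
      left end of a flat piece ending in \<open>m\<close>. Such a piece is null, also after
      conditioning, so \<open>?G\<close> equals \<open>p\<close> at the left end too, and minimality
      of \<open>m\<close> closes the gap.\<close>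
    have "AE \<omega> in M. X \<omega> \<le> VaR M X (?F m) \<longleftrightarrow> X \<omega> \<le> m"
      by (rule cdf_eq_imp_AE_le_iff[OF X cdf_VaR[OF X cont pos lt1]])
    then have "prob {\<omega>\<in>A. X \<omega> \<le> VaR M X (?F m)} = prob {\<omega>\<in>A. X \<omega> \<le> m}"
      by (intro finite_measure_eq_AE meas) auto
    then have "?G (VaR M X (?F m)) = p"
      using Gm by (simp add: G)
    then show "m \<le> VaR M X (?F m)"
      unfolding m_def by (simp add: U.VaR_le_iff[OF XU p])
  qed
qed

end

section \<open>Comparing conditional quantile levels on two probability spaces\<close>

text \<open>\<open>H\<close> is the copula section that gives the joint probability of conditioning event and
  marginal level.\<close>

lemma conditional_level_le:
  fixes M :: "'a measure" and N :: "'b measure" and H :: "real \<Rightarrow> real"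
  assumes M: "prob_space M" and N: "prob_space N"
    and A: "A \<in> sets M" "0 < measure M A" and B: "B \<in> sets N" "0 < measure N B"
    and AB: "measure M A = measure N B"
    and X: "X \<in> borel_measurable M" and Y: "Y \<in> borel_measurable N"
    and contX: "continuous_on UNIV (cdf (distr M borel X))"
    and contY: "continuous_on UNIV (cdf (distr N borel Y))"
    and p: "0 < p" "p < 1"
    and HX: "\<And>x. measure M {\<omega>\<in>A. X \<omega> \<le> x} = H (cdf (distr M borel X) x)"
    and HY: "\<And>y. measure N {\<omega>\<in>B. Y \<omega> \<le> y} = H (cdf (distr N borel Y) y)"
  shows "cdf (distr N borel Y) (VaR (uniform_measure N B) Y p) \<le>
    cdf (distr M borel X) (VaR (uniform_measure M A) X p)"
proof -
  interpret M: prob_space M by fact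
  interpret N: prob_space N by fact
  interpret UM: prob_space "uniform_measure M A" by (rule M.prob_space_uniform_measure_pos) fact
  interpret UN: prob_space "uniform_measure N B" by (rule N.prob_space_uniform_measure_pos) fact
  interpret D: real_distribution "distr N borel Y" using Y by simp
  define m where "m = VaR (uniform_measure M A) X p"
  \<comment> \<open>The witness \<open>y\<close> has the same marginal level for \<open>Y\<close> as
    \<open>m\<close> has for \<open>X\<close>. Through \<open>H\<close> its conditional distribution
    value is \<open>p\<close> as well, so the conditional quantile of \<open>Y\<close> is at most
    \<open>y\<close>.\<close>
  define y where "y = VaR N Y (cdf (distr M borel X) m)"
  have XU: "X \<in> borel_measurable (uniform_measure M A)"
    and YU: "Y \<in> borel_measurable (uniform_measure N B)" using X Y by auto
  have Fy: "cdf (distr N borel Y) y = cdf (distr M borel X) m"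
    unfolding y_def using M.VaR_uniform_measure[OF A X contX p] contY Y m_def
    by (intro N.cdf_VaR) auto
  have "cdf (distr (uniform_measure M A) borel X) m = p"
    unfolding m_def
    by (rule UM.cdf_VaR[OF XU M.continuous_cdf_uniform_measure[OF A X contX] p])
  then have "cdf (distr (uniform_measure N B) borel Y) y = p"
    by (simp add: N.cdf_distr_uniform_measure[OF B Y] M.cdf_distr_uniform_measure[OF A X]
        HX HY Fy AB)
  then have "VaR (uniform_measure N B) Y p \<le> y"
    by (simp add: UN.VaR_le_iff[OF YU p])
  then show ?thesis
    unfolding m_def[symmetric] Fy[symmetric] by (rule D.cdf_nondecreasing)
qed

section \<open>Mixed orthant probabilities\<close>

text \<open>Reversing the inequality in one coordinate subtracts from the event with bound \<open>1\<close> in that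
  coordinate, so lower orthant probabilities determine the mixed ones.\<close>

lemma mixed_orthant_prob_insert:
  fixes W :: "'i \<Rightarrow> 'a \<Rightarrow> real"
  assumes "prob_space M" and I: "finite I" and W[measurable]: "\<And>i. i \<in> I \<Longrightarrow> W i \<in> borel_measurable M"
    and j: "j \<in> I" "j \<notin> J" "u j \<le> 1" and W1: "\<And>i \<omega>. i \<in> I \<Longrightarrow> W i \<omega> \<le> 1"
  shows "\<P>(\<omega> in M. \<forall>i\<in>I. if i \<in> insert j J then u i < W i \<omega> else W i \<omega> \<le> u i) =
    \<P>(\<omega> in M. \<forall>i\<in>I. if i \<in> J then (u(j := 1)) i < W i \<omega> else W i \<omega> \<le> (u(j := 1)) i)
    - \<P>(\<omega> in M. \<forall>i\<in>I. if i \<in> J then u i < W i \<omega> else W i \<omega> \<le> u i)"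
proof -
  interpret prob_space M by fact
  let ?S = "\<lambda>u J. {\<omega>\<in>space M. \<forall>i\<in>I. if i \<in> J then u i < W i \<omega> else W i \<omega> \<le> u i}"
  have S: "?S v L \<in> events" for v L
  proof (rule sets.sets_Collect_finite_All[OF _ I])
    fix i assume "i \<in> I"
    then have [measurable]: "W i \<in> borel_measurable M" by (rule W)
    show "{\<omega> \<in> space M. if i \<in> L then v i < W i \<omega> else W i \<omega> \<le> v i} \<in> events"
      by (cases "i \<in> L") auto
  qed
  have "?S u (insert j J) = ?S (u(j := 1)) J - ?S u J"
  proof (rule set_eqI)
    fix \<omega>
    \<comment> \<open>All three events impose the same constraints off \<open>j\<close>. With
      \<open>j\<close> isolated, only \<open>u j < W j \<omega>\<close> remains to be compared with
      the vacuous bound 1 minus the event \<open>W j \<omega> \<le> u j\<close>.\<close>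
    have "(\<forall>i\<in>I. if i \<in> L then v i < W i \<omega> else W i \<omega> \<le> v i) \<longleftrightarrow>
        (if j \<in> L then v j < W j \<omega> else W j \<omega> \<le> v j) \<and>
        (\<forall>i\<in>I-{j}. if i \<in> L then v i < W i \<omega> else W i \<omega> \<le> v i)" for v L
      using j(1) by blast
    note split = this
    show "\<omega> \<in> ?S u (insert j J) \<longleftrightarrow> \<omega> \<in> ?S (u(j := 1)) J - ?S u J"
      using j W1[of j \<omega>] unfolding mem_Collect_eq Diff_iff split by auto
  qed
  moreover have "?S u J \<subseteq> ?S (u(j := 1)) J"
    using j W1 by auto
  ultimately show ?thesis
    by (simp only: finite_measure_Diff[OF S S])
qed

text \<open>Induction on the set of reversed coordinates: each reversal is a difference of two
  probabilities with one reversal fewer. The vector \<open>u\<close> is kept arbitrary because one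
  of these two uses \<open>u(j := 1)\<close>.\<close>

lemma mixed_orthant_prob_eq:
  fixes U :: "'i \<Rightarrow> 'a \<Rightarrow> real" and V :: "'i \<Rightarrow> 'b \<Rightarrow> real"
  assumes M: "prob_space M" and N: "prob_space N" and I: "finite I"
    and U: "\<And>i. i \<in> I \<Longrightarrow> U i \<in> borel_measurable M"
    and V: "\<And>i. i \<in> I \<Longrightarrow> V i \<in> borel_measurable N"
    and U1: "\<And>i \<omega>. i \<in> I \<Longrightarrow> U i \<omega> \<le> 1"
    and V1: "\<And>i \<omega>. i \<in> I \<Longrightarrow> V i \<omega> \<le> 1"
    and eq: "\<And>u. (\<forall>i\<in>I. u i \<in> {0..1}) \<Longrightarrow>
      \<P>(\<omega> in M. \<forall>i\<in>I. U i \<omega> \<le> u i) = \<P>(\<omega> in N. \<forall>i\<in>I. V i \<omega> \<le> u i)"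
    and "J \<subseteq> I" and u: "\<forall>i\<in>I. u i \<in> {0..1}"
  shows "\<P>(\<omega> in M. \<forall>i\<in>I. if i \<in> J then u i < U i \<omega> else U i \<omega> \<le> u i) =
         \<P>(\<omega> in N. \<forall>i\<in>I. if i \<in> J then u i < V i \<omega> else V i \<omega> \<le> u i)"
proof -
  have "finite J" using \<open>J \<subseteq> I\<close> I by (rule finite_subset)
  then show ?thesis
    using \<open>J \<subseteq> I\<close> u
  proof (induction J arbitrary: u)
    case empty
    then show ?case using eq by simp
  next
    case (insert j J)
    then have j: "j \<in> I" "u j \<le> 1" and J: "J \<subseteq> I" by auto
    have u1: "\<forall>i\<in>I. (u(j := 1)) i \<in> {0..1}"
      using insert.prems by auto
    show ?case
      by (simp only: mixed_orthant_prob_insert[of M I U j J u, OF M I U j(1) insert.hyps(2) j(2) U1]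
          mixed_orthant_prob_insert[of N I V j J u, OF N I V j(1) insert.hyps(2) j(2) V1]
          insert.IH[OF J insert.prems(2)] insert.IH[OF J u1])
  qed
qed

section \<open>Random vectors with continuous margins\<close>

locale continuous_margins = prob_space M for M :: "'a measure" +
  fixes n :: nat and X :: "nat \<Rightarrow> 'a \<Rightarrow> real"
  assumes n_pos: "1 \<le> n"
    and X_measurable: "i \<in> {1..n} \<Longrightarrow> X i \<in> borel_measurable M"
    and X_cont: "i \<in> {1..n} \<Longrightarrow> continuous_on UNIV (cdf (distr M borel (X i)))"
begin

abbreviation F :: "nat \<Rightarrow> real \<Rightarrow> real" where
  "F i \<equiv> cdf (distr M borel (X i))"

lemma X1: "X 1 \<in> borel_measurable M" "continuous_on UNIV (F 1)"
  using n_pos by (auto intro: X_measurable X_cont)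

lemma F_unit: "F i x \<in> {0..1}" if "i \<in> {1..n}"
proof -
  interpret D: real_distribution "distr M borel (X i)" using X_measurable[OF that] by simp
  show ?thesis using D.cdf_nonneg D.cdf_bounded_prob by simp
qed

lemma F_X_measurable: "i \<in> {1..n} \<Longrightarrow> (\<lambda>\<omega>. F i (X i \<omega>)) \<in> borel_measurable M"
proof -
  assume i: "i \<in> {1..n}"
  interpret D: cdf_distribution "distr M borel (X i)"
    using X_measurable[OF i] by (simp add: cdf_distribution_def)
  show ?thesis
    using X_measurable[OF i] D.measurable_C by (rule measurable_compose)
qed

lemma tail_event: "{\<omega>\<in>space M. \<forall>k\<in>{2..n}. x k < X k \<omega>} \<in> events"
proof (rule sets.sets_Collect_finite_All)
  fix k assume "k \<in> {2..n}"
  then have [measurable]: "X k \<in> borel_measurable M" by (intro X_measurable) auto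
  show "{\<omega>\<in>space M. x k < X k \<omega>} \<in> events" by measurable
qed auto

lemma stress_event_measurable: "stress_event n M X p \<in> events"
  unfolding stress_event_def by (rule tail_event)

lemma AE_stress_event_iff:
  assumes p: "\<forall>j\<in>{2..n}. p j \<in> {0<..<1}"
  shows "AE \<omega> in M. \<omega> \<in> stress_event n M X p \<longleftrightarrow> (\<forall>j\<in>{2..n}. p j < F j (X j \<omega>))"
proof -
  have "AE \<omega> in M. \<forall>j\<in>{2..n}. VaR M (X j) (p j) < X j \<omega> \<longleftrightarrow> p j < F j (X j \<omega>)"
  proof (rule AE_finite_allI)
    fix j assume j: "j \<in> {2..n}"
    then show "AE \<omega> in M. VaR M (X j) (p j) < X j \<omega> \<longleftrightarrow> p j < F j (X j \<omega>)"
      using bspec[OF p j] by (intro AE_VaR_less_iff X_measurable X_cont) auto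
  qed simp
  with AE_space show ?thesis
    by eventually_elim (auto simp: stress_event_def)
qed

text \<open>Matches the mixed orthant with reversed coordinates \<open>{2..n}\<close> to the joint
  event of a bound on the first coordinate and stress on the others.\<close>

lemma all_split_first: "(\<forall>i\<in>{1..n}. if i \<in> {2..n} then P i else Q i) \<longleftrightarrow> Q 1 \<and> (\<forall>i\<in>{2..n}. P i)"
proof -
  have "{1..n} = insert 1 {2..n}" using n_pos by auto
  then show ?thesis by simp
qed

lemma mixed_event: "{\<omega>\<in>space M. F 1 (X 1 \<omega>) \<le> v \<and> (\<forall>j\<in>{2..n}. p j < F j (X j \<omega>))} \<in> events"
proof -
  have "{\<omega>\<in>space M. \<forall>j\<in>{2..n}. p j < F j (X j \<omega>)} \<in> events"
  proof (rule sets.sets_Collect_finite_All)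
    fix k assume "k \<in> {2..n}"
    then have [measurable]: "(\<lambda>\<omega>. F k (X k \<omega>)) \<in> borel_measurable M" by (intro F_X_measurable) auto
    show "{\<omega>\<in>space M. p k < F k (X k \<omega>)} \<in> events" by measurable
  qed auto
  moreover have "{\<omega>\<in>space M. F 1 (X 1 \<omega>) \<le> v} \<in> events"
    using borel_measurable_le[OF F_X_measurable[of 1] borel_measurable_const] n_pos by simp
  ultimately show ?thesis by (intro sets.sets_Collect_conj)
qed

text \<open>After the passage to the variables \<open>F i (X i \<omega>)\<close>, the threshold
  \<open>x\<close> enters only through \<open>F 1 x\<close>.\<close>

lemma prob_stress_event_le:
  assumes p: "\<forall>j\<in>{2..n}. p j \<in> {0<..<1}"
  shows "prob {\<omega>\<in>stress_event n M X p. X 1 \<omega> \<le> x} =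
    \<P>(\<omega> in M. F 1 (X 1 \<omega>) \<le> F 1 x \<and> (\<forall>j\<in>{2..n}. p j < F j (X j \<omega>)))"
proof (rule finite_measure_eq_AE)
  show "AE \<omega> in M. \<omega> \<in> {\<omega>\<in>stress_event n M X p. X 1 \<omega> \<le> x} \<longleftrightarrow>
      \<omega> \<in> {\<omega>\<in>space M. F 1 (X 1 \<omega>) \<le> F 1 x \<and> (\<forall>j\<in>{2..n}. p j < F j (X j \<omega>))}"
    using AE_stress_event_iff[OF p] AE_le_iff_cdf_le[OF X1, of x] AE_space
    by eventually_elim auto
  have "{\<omega>\<in>stress_event n M X p. X 1 \<omega> \<le> x} = stress_event n M X p \<inter> {\<omega>\<in>space M. X 1 \<omega> \<le> x}"
    by (auto simp: stress_event_def)
  with stress_event_measurable X1 show "{\<omega>\<in>stress_event n M X p. X 1 \<omega> \<le> x} \<in> events"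
    by simp
qed (rule mixed_event)

text \<open>The vacuous bound 1 on the first coordinate gives this probability the same form as the
  previous one, so the copula determines it in the same way.\<close>

lemma prob_stress_event:
  assumes p: "\<forall>j\<in>{2..n}. p j \<in> {0<..<1}"
  shows "prob (stress_event n M X p) =
    \<P>(\<omega> in M. F 1 (X 1 \<omega>) \<le> 1 \<and> (\<forall>j\<in>{2..n}. p j < F j (X j \<omega>)))"
proof (rule finite_measure_eq_AE)
  show "AE \<omega> in M. \<omega> \<in> stress_event n M X p \<longleftrightarrow>
      \<omega> \<in> {\<omega>\<in>space M. F 1 (X 1 \<omega>) \<le> 1 \<and> (\<forall>j\<in>{2..n}. p j < F j (X j \<omega>))}"
    using AE_stress_event_iff[OF p] AE_space
    by eventually_elim (use F_unit[of 1] n_pos in auto)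
qed (rule stress_event_measurable mixed_event)+

lemma MCoVaR_level:
  assumes "0 < p 1" "p 1 < 1" "0 < prob (stress_event n M X p)"
  shows "0 < F 1 (MCoVaR n M X p)" "F 1 (MCoVaR n M X p) < 1"
    "VaR M (X 1) (F 1 (MCoVaR n M X p)) = MCoVaR n M X p"
  unfolding MCoVaR_def
  using VaR_uniform_measure[OF stress_event_measurable assms(3) X1 assms(1,2)] by auto

section \<open>Monotonicity in the stress levels\<close>

text \<open>The definition raises one threshold at a time, so the thresholds are raised successively
  by induction. Every intermediate vector lies below \<open>y\<close> on \<open>{2..n}\<close>, and
  so its conditioning event inherits positive probability.\<close>

lemma right_tail_increasing_cond_prob_mono:
  assumes rti: "right_tail_increasing n M X"
    and le: "\<And>k. k \<in> {2..n} \<Longrightarrow> x k \<le> y k"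
    and pos: "\<P>(\<omega> in M. \<forall>k\<in>{2..n}. y k < X k \<omega>) > 0"
  shows "\<P>(\<omega> in M. t < X 1 \<omega> \<bar> \<forall>k\<in>{2..n}. x k < X k \<omega>)
    \<le> \<P>(\<omega> in M. t < X 1 \<omega> \<bar> \<forall>k\<in>{2..n}. y k < X k \<omega>)"
proof -
  define z where "z J = (\<lambda>k. if k \<in> J then y k else x k)" for J
  define c where "c w = \<P>(\<omega> in M. t < X 1 \<omega> \<bar> \<forall>k\<in>{2..n}. w k < X k \<omega>)" for w
  have "c x \<le> c (z J)" if "finite J" "J \<subseteq> {2..n}" for J
    using that
  proof (induction J)
    case empty
    then show ?case by (simp add: z_def)
  next
    case (insert j J)
    then have j: "j \<in> {2..n}" by auto
    have z: "z (insert j J) = (z J)(j := y j)"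
      by (auto simp: z_def)
    have "\<P>(\<omega> in M. \<forall>k\<in>{2..n}. y k < X k \<omega>) \<le> \<P>(\<omega> in M. \<forall>k\<in>{2..n}. z (insert j J) k < X k \<omega>)"
    proof (rule finite_measure_mono[OF _ tail_event], safe)
      fix \<omega> k assume "\<forall>k\<in>{2..n}. y k < X k \<omega>" and k: "k \<in> {2..n}"
      then show "z (insert j J) k < X k \<omega>"
        using le[OF k] by (fastforce simp: z_def)
    qed
    with pos have "0 < \<P>(\<omega> in M. \<forall>k\<in>{2..n}. ((z J)(j := y j)) k < X k \<omega>)"
      unfolding z by linarith
    moreover have "z J j \<le> y j" using le[OF j] by (simp add: z_def)
    ultimately have "c (z J) \<le> c ((z J)(j := y j))"
      using rti j unfolding right_tail_increasing_def c_def by blast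
    with insert.IH insert.prems show ?case
      unfolding z by (blast intro: order_trans)
  qed
  from this[of "{2..n}"] have "c x \<le> c (z {2..n})" by simp
  \<comment> \<open>The vectors \<open>z {2..n}\<close> and \<open>y\<close> need agree only on
    \<open>{2..n}\<close>, which is all that \<open>c\<close> looks at.\<close>
  also have "c (z {2..n}) = c y"
    unfolding c_def z_def by (simp cong: conj_cong)
  finally show ?thesis unfolding c_def .
qed

lemma cdf_given_stress_event:
  assumes "0 < prob (stress_event n M X p)"
  shows "cdf (distr (uniform_measure M (stress_event n M X p)) borel (X 1)) t =
    1 - \<P>(\<omega> in M. t < X 1 \<omega> \<bar> \<forall>k\<in>{2..n}. VaR M (X k) (p k) < X k \<omega>)"
proof -
  let ?A = "stress_event n M X p"
  have "{\<omega>\<in>?A. X 1 \<omega> \<le> t} = ?A - {\<omega>\<in>space M. t < X 1 \<omega>}"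
    by (auto simp: stress_event_def)
  moreover have "prob (?A - {\<omega>\<in>space M. t < X 1 \<omega>}) = prob ?A - prob (?A \<inter> {\<omega>\<in>space M. t < X 1 \<omega>})"
    using stress_event_measurable X1 by (intro finite_measure_Diff') auto
  moreover have "?A \<inter> {\<omega>\<in>space M. t < X 1 \<omega>} =
      {\<omega>\<in>space M. t < X 1 \<omega> \<and> (\<forall>k\<in>{2..n}. VaR M (X k) (p k) < X k \<omega>)}"
    by (auto simp: stress_event_def)
  ultimately show ?thesis
    using assms cdf_distr_uniform_measure[OF stress_event_measurable assms X1(1)]
    by (simp add: cond_prob_def stress_event_def diff_divide_distrib)
qed

text \<open>Higher levels mean higher thresholds, which by RTI increase the conditional survival
  probability. The conditional distribution function drops, and its quantile at the common level
  \<open>p 1\<close> moves up.\<close>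

lemma MCoVaR_mono_levels:
  assumes rti: "right_tail_increasing n M X"
    and p: "0 < p 1" "p 1 < 1" and q1: "q 1 = p 1"
    and le: "\<And>j. j \<in> {2..n} \<Longrightarrow> 0 < q j \<and> q j \<le> p j \<and> p j < 1"
    and posp: "0 < prob (stress_event n M X p)" and posq: "0 < prob (stress_event n M X q)"
  shows "MCoVaR n M X q \<le> MCoVaR n M X p"
proof -
  define m where "m = MCoVaR n M X p"
  let ?G = "\<lambda>p. cdf (distr (uniform_measure M (stress_event n M X p)) borel (X 1))"
  interpret P: prob_space "uniform_measure M (stress_event n M X p)"
    by (rule prob_space_uniform_measure_pos) fact
  interpret Q: prob_space "uniform_measure M (stress_event n M X q)"
    by (rule prob_space_uniform_measure_pos) fact
  have "VaR M (X j) (q j) \<le> VaR M (X j) (p j)" if j: "j \<in> {2..n}" for j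
  proof -
    have "X j \<in> borel_measurable M" using j by (intro X_measurable) auto
    then show ?thesis
      using le[OF j] VaR_le_iff[of "X j" "q j"] VaR_le_iff[of "X j" "p j" "VaR M (X j) (p j)"] by auto
  qed
  then have "\<P>(\<omega> in M. m < X 1 \<omega> \<bar> \<forall>k\<in>{2..n}. VaR M (X k) (q k) < X k \<omega>)
      \<le> \<P>(\<omega> in M. m < X 1 \<omega> \<bar> \<forall>k\<in>{2..n}. VaR M (X k) (p k) < X k \<omega>)"
    using posp by (intro right_tail_increasing_cond_prob_mono[OF rti]) (auto simp: stress_event_def)
  then have "?G p m \<le> ?G q m"
    unfolding cdf_given_stress_event[OF posp] cdf_given_stress_event[OF posq] by linarith
  moreover have "p 1 \<le> ?G p m"
    using P.VaR_le_iff[of "X 1" "p 1" m] X1 p by (simp add: m_def MCoVaR_def)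
  ultimately show ?thesis
    using Q.VaR_le_iff[of "X 1" "q 1" m] X1 p q1 by (simp add: m_def MCoVaR_def)
qed

end

section \<open>Transfer between vectors with the same copula, and the comparison of
  contributions\<close>

text \<open>The hypotheses of \<open>conditional_level_le\<close> are symmetric in the two vectors
  once the copula supplies a common \<open>H\<close>, so both inequalities follow from it.\<close>

lemma same_copula_MCoVaR_level:
  assumes M: "continuous_margins M n X" and N: "continuous_margins N n Y"
    and C: "has_copula n M X C" "has_copula n N Y C"
    and p: "\<forall>j\<in>{1..n}. p j \<in> {0<..<1}"
    and pos: "0 < measure M (stress_event n M X p)" "0 < measure N (stress_event n N Y p)"
  shows "cdf (distr M borel (X 1)) (MCoVaR n M X p) = cdf (distr N borel (Y 1)) (MCoVaR n N Y p)"
proof -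
  interpret M: continuous_margins M n X by fact
  interpret N: continuous_margins N n Y by fact
  define H where "H v = \<P>(\<omega> in M. M.F 1 (X 1 \<omega>) \<le> v \<and> (\<forall>j\<in>{2..n}. p j < M.F j (X j \<omega>)))" for v
  have H: "H v = \<P>(\<omega> in N. N.F 1 (Y 1 \<omega>) \<le> v \<and> (\<forall>j\<in>{2..n}. p j < N.F j (Y j \<omega>)))"
    if v: "v \<in> {0..1}" for v
  proof -
    \<comment> \<open>The first slot holds the bound on the marginal level, the others keep the
      stress levels.\<close>
    define u where "u = p(1 := v)"
    have "u i \<in> {0..1}" if "i \<in> {1..n}" for i
      using bspec[OF p that] v by (auto simp: u_def)
    then have u: "\<forall>i\<in>{1..n}. u i \<in> {0..1}" by blast
    have copula: "\<P>(\<omega> in M. \<forall>i\<in>{1..n}. M.F i (X i \<omega>) \<le> u i) =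
        \<P>(\<omega> in N. \<forall>i\<in>{1..n}. N.F i (Y i \<omega>) \<le> u i)"
      if "\<forall>i\<in>{1..n}. u i \<in> {0..1}" for u
      using C that by (simp add: has_copula_def)
    have "\<P>(\<omega> in M. \<forall>i\<in>{1..n}. if i \<in> {2..n} then u i < M.F i (X i \<omega>) else M.F i (X i \<omega>) \<le> u i) =
        \<P>(\<omega> in N. \<forall>i\<in>{1..n}. if i \<in> {2..n} then u i < N.F i (Y i \<omega>) else N.F i (Y i \<omega>) \<le> u i)"
      using M.F_unit N.F_unit
      by (intro mixed_orthant_prob_eq[where I = "{1..n}" and J = "{2..n}" and u = u
            and U = "\<lambda>i \<omega>. M.F i (X i \<omega>)" and V = "\<lambda>i \<omega>. N.F i (Y i \<omega>)"]
          M.prob_space_axioms N.prob_space_axioms M.F_X_measurable N.F_X_measurable copula u) auto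
    moreover have "(\<forall>i\<in>{2..n}. u i < w i) \<longleftrightarrow> (\<forall>i\<in>{2..n}. p i < w i)" for w
      by (simp add: u_def)
    moreover have "u 1 = v" by (simp add: u_def)
    ultimately show ?thesis
      unfolding M.all_split_first H_def by (simp only:)
  qed
  have p1: "0 < p 1" "p 1 < 1" and p2: "\<forall>j\<in>{2..n}. p j \<in> {0<..<1}"
    using bspec[OF p, of 1] p M.n_pos by simp_all
  have HX: "measure M {\<omega>\<in>stress_event n M X p. X 1 \<omega> \<le> x} = H (M.F 1 x)" for x
    unfolding H_def by (rule M.prob_stress_event_le[OF p2])
  have HY: "measure N {\<omega>\<in>stress_event n N Y p. Y 1 \<omega> \<le> y} = H (N.F 1 y)" for y
    unfolding N.prob_stress_event_le[OF p2]
    using N.F_unit[of 1 y] N.n_pos by (intro H[symmetric]) simp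
  have eq: "measure M (stress_event n M X p) = measure N (stress_event n N Y p)"
    unfolding M.prob_stress_event[OF p2] N.prob_stress_event[OF p2] H_def[symmetric]
    by (rule H) simp
  have "N.F 1 (MCoVaR n N Y p) \<le> M.F 1 (MCoVaR n M X p)"
    unfolding MCoVaR_def
    by (rule conditional_level_le[OF M.prob_space_axioms N.prob_space_axioms
          M.stress_event_measurable pos(1) N.stress_event_measurable pos(2) eq
          M.X1(1) N.X1(1) M.X1(2) N.X1(2) p1 HX HY])
  moreover have "M.F 1 (MCoVaR n M X p) \<le> N.F 1 (MCoVaR n N Y p)"
    unfolding MCoVaR_def
    by (rule conditional_level_le[OF N.prob_space_axioms M.prob_space_axioms
          N.stress_event_measurable pos(2) M.stress_event_measurable pos(1) eq[symmetric]
          N.X1(1) M.X1(1) N.X1(2) M.X1(2) p1 HY HX])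
  ultimately show ?thesis by (rule antisym[rotated])
qed

theorem theorem3p11:
  fixes n :: nat
    and M :: "'a measure" and N :: "'b measure"
    and X :: "nat \<Rightarrow> 'a \<Rightarrow> real" and Y :: "nat \<Rightarrow> 'b \<Rightarrow> real"
    and f g :: "(nat \<Rightarrow> real) \<Rightarrow> ennreal"
    and C :: "(nat \<Rightarrow> real) \<Rightarrow> real"
    and p :: "nat \<Rightarrow> real"
  assumes "n \<ge> 2"
    and "prob_space M" and "prob_space N"
    and "distributed M (Pi\<^sub>M {1..n} (\<lambda>_. lborel)) (\<lambda>\<omega>. \<lambda>i\<in>{1..n}. X i \<omega>) f"
    and "distributed N (Pi\<^sub>M {1..n} (\<lambda>_. lborel)) (\<lambda>\<omega>. \<lambda>i\<in>{1..n}. Y i \<omega>) g"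
    and "\<forall>i\<in>{1..n}. AE \<omega> in M. X i \<omega> \<ge> 0"
    and "\<forall>i\<in>{1..n}. AE \<omega> in N. Y i \<omega> \<ge> 0"
    and "\<forall>i\<in>{1..n}. continuous_on UNIV (cdf (distr M borel (X i)))"
    and "\<forall>i\<in>{1..n}. continuous_on UNIV (cdf (distr N borel (Y i)))"
    and "\<forall>i\<in>{1..n}. integrable M (X i)"
    and "\<forall>i\<in>{1..n}. integrable N (Y i)"
    and "has_copula n M X C" and "has_copula n N Y C"
    and "right_tail_increasing n M X"
    and "p 1 \<in> {0<..<1}"
    and "\<forall>j\<in>{2..n}. p j \<in> {1/2<..<1}"
    and "measure M (stress_event n M X p) > 0"
    and "measure M (stress_event n M X (median_levels p)) > 0"
    and "measure N (stress_event n N Y p) > 0"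
    and "measure N (stress_event n N Y (median_levels p)) > 0"
    and "MCoVaR n M X (median_levels p) \<noteq> 0"
    and "MCoVaR n N Y (median_levels p) \<noteq> 0"
    and "star_order M (X 1) N (Y 1)"
  shows "Delta_R_med_MCoVaR n M X p \<le> Delta_R_med_MCoVaR n N Y p"
proof -
  note A = assms
  let ?r = "median_levels p"
  interpret M: prob_space M by fact
  interpret N: prob_space N by fact
  interpret X: continuous_margins M n X
    by unfold_locales (use A(1,8,10) in auto)
  interpret Y: continuous_margins N n Y
    by unfold_locales (use A(1,9,11) in auto)
  have one: "1 \<in> {1..n}" using A(1) by simp
  have p1: "0 < p 1" "p 1 < 1" using A(15) by auto
  have r1: "?r 1 = p 1" by (simp add: median_levels_def)
  have level: "p j \<in> {0<..<1}" "?r j \<in> {0<..<1}" if "j \<in> {1..n}" for j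
  proof -
    have "j = 1 \<or> j \<in> {2..n}" using that by auto
    then show "p j \<in> {0<..<1}" "?r j \<in> {0<..<1}"
      using p1 bspec[OF A(16), of j] by (auto simp: median_levels_def)
  qed
  \<comment> \<open>The levels \<open>q\<close> and \<open>r\<close> are computed from
    \<open>X\<close>; the shared copula makes them the levels for \<open>Y\<close> too.\<close>
  define q where "q = X.F 1 (MCoVaR n M X p)"
  define r where "r = X.F 1 (MCoVaR n M X ?r)"
  have q': "q = Y.F 1 (MCoVaR n N Y p)"
    unfolding q_def using level A(17,19)
    by (intro same_copula_MCoVaR_level[OF X.continuous_margins_axioms Y.continuous_margins_axioms A(12,13)]) auto
  have r': "r = Y.F 1 (MCoVaR n N Y ?r)"
    unfolding r_def using level A(18,20)
    by (intro same_copula_MCoVaR_level[OF X.continuous_margins_axioms Y.continuous_margins_axioms A(12,13)]) auto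
  have q: "0 < q" "q < 1" and Xq: "MCoVaR n M X p = VaR M (X 1) q"
    using X.MCoVaR_level[OF p1 A(17)] by (simp_all only: q_def)
  have r: "0 < r" "r < 1" and Xr: "MCoVaR n M X ?r = VaR M (X 1) r"
    using X.MCoVaR_level[of ?r, unfolded r1, OF p1 A(18)] by (simp_all only: r_def)
  have Yq: "MCoVaR n N Y p = VaR N (Y 1) q"
    using Y.MCoVaR_level[OF p1 A(19)] by (simp only: q')
  have Yr: "MCoVaR n N Y ?r = VaR N (Y 1) r"
    using Y.MCoVaR_level[of ?r, unfolded r1, OF p1 A(20)] by (simp only: r')
  interpret D: real_distribution "distr M borel (X 1)" using X.X1(1) by (rule M.real_distribution_distr)
  have "MCoVaR n M X ?r \<le> MCoVaR n M X p"
  proof (rule X.MCoVaR_mono_levels[OF A(14) p1 r1 _ A(17,18)])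
    show "0 < ?r j \<and> ?r j \<le> p j \<and> p j < 1" if "j \<in> {2..n}" for j
      using bspec[OF A(16) that] that by (auto simp: median_levels_def)
  qed
  then have "r \<le> q"
    unfolding q_def r_def by (rule D.cdf_nondecreasing)
  then have star: "VaR N (Y 1) r / VaR M (X 1) r \<le> VaR N (Y 1) q / VaR M (X 1) q"
    using mono_onD[OF A(23)[unfolded star_order_def], of r q] q r by simp
  have pos: "0 < VaR M (X 1) s" "0 < VaR N (Y 1) s" if "0 < s" "s < 1" for s
    using M.VaR_pos[OF X.X1 bspec[OF A(6) one] that] N.VaR_pos[OF Y.X1 bspec[OF A(7) one] that]
    by auto
  \<comment> \<open>Cross-multiplication by positive quantiles turns the star order between levels
    \<open>r\<close> and \<open>q\<close> into this comparison; each contribution is the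
    corresponding ratio minus 1.\<close>
  have "VaR M (X 1) q / VaR M (X 1) r \<le> VaR N (Y 1) q / VaR N (Y 1) r"
    using star pos[OF q] pos[OF r] by (simp add: field_simps)
  then show ?thesis
    using pos[OF r] by (simp add: Delta_R_med_MCoVaR_def Xq Xr Yq Yr diff_divide_distrib)
qed

end
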